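(* Let $M_4$ be the complex $n$-dimensional Leibniz algebra with basis $\{y_1,\dots,y_n\}$ and products $[y_1,y_1]=y_n$, $[y_i,y_1]=y_{i+1}$ for $2\le i\le n-1$, $[y_1,y_i]=-y_{i+1}$ for $2\le i\le n-1$, all other products of basis elements being zero. Define linear maps $h_0,h_1,d_j$ ($3-n\le j\le n-2$) on $M_4$ (zero on every basis vector on which no value is specified) by $d_{j-n}(y_1)=y_{j-1}$ for $3\le j\le n$; $d_j(y_i)=y_{i+j}$ for $2\le i\le n-j$, for each $1\le j\le n-2$; $h_0(y_1)=y_1$, and $h_0(y_i)=(2-n+i)y_i$ for $2\le i\le n$; $h_1(y_1)=y_n$. Then $h_0$, $h_1$ and $d_j$ ($3-n\le j\le n-2$) form a basis of the space $Der(M_4)$.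
   Context: A Leibniz algebra is a vector space $L$ with a bilinear product satisfying $[x,[y,z]]=[[x,y],z]-[[x,z],y]$. A derivation of $L$ is a linear map $d:L\to L$ with $d([x,y])=[d(x),y]+[x,d(y)]$ for all $x,y\in L$; $Der(L)$ denotes the vector space of all derivations of $L$. *)

theory Defs
  imports Complex_Main "HOL-Library.Function_Algebras"
begin

locale leibniz_algebra = vector_space scale
  for scale :: "'k::field \<Rightarrow> 'a::ab_group_add \<Rightarrow> 'a" (infixr \<open>*s\<close> 75) +
  fixes bracket :: "'a \<Rightarrow> 'a \<Rightarrow> 'a"
  assumes linear_bracket_left: "Vector_Spaces.linear scale scale (\<lambda>x. bracket x y)"
    and linear_bracket_right: "Vector_Spaces.linear scale scale (\<lambda>y. bracket x y)"
    and leibniz_identity: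
      "bracket x (bracket y z) = bracket (bracket x y) z - bracket (bracket x z) y"
begin

definition Der :: "('a \<Rightarrow> 'a) set" where
  "Der = {d. Vector_Spaces.linear scale scale d \<and>
             (\<forall>x y. d (bracket x y) = bracket (d x) y + bracket x (d y))}"

end

(* Together with the pointwise addition of Function_Algebras, this is the usual vector space
   structure on maps. *)
definition fun_scale :: "('k \<Rightarrow> 'a \<Rightarrow> 'a) \<Rightarrow> 'k \<Rightarrow> ('b \<Rightarrow> 'a) \<Rightarrow> ('b \<Rightarrow> 'a)" where
  "fun_scale scale c f = (\<lambda>x. scale c (f x))"

lemma vector_space_fun_scale:
  assumes "vector_space scale"
  shows "vector_space (fun_scale scale)"
proof -
  interpret vector_space scale by (fact assms)
  show ?thesis
    by unfold_locales
      (auto simp: fun_scale_def fun_eq_iff scale_right_distrib scale_left_distrib)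
qed

(* The vectors y 1, ..., y n form a basis; the values of y outside {1..n} are irrelevant. *)
locale M4_algebra = leibniz_algebra scale bracket
  for scale :: "complex \<Rightarrow> 'a::ab_group_add \<Rightarrow> 'a" (infixr \<open>*s\<close> 75)
    and bracket :: "'a \<Rightarrow> 'a \<Rightarrow> 'a" +
  fixes y :: "nat \<Rightarrow> 'a" and n :: nat
  assumes n_ge_2: "n \<ge> 2"
    and inj_y: "inj_on y {1..n}"
    and independent_y: "independent (y ` {1..n})"
    and span_y: "span (y ` {1..n}) = UNIV"
    and bracket_1_1: "bracket (y 1) (y 1) = y n"
    and bracket_i_1: "i \<in> {2..n-1} \<Longrightarrow> bracket (y i) (y 1) = y (i + 1)"
    and bracket_1_i: "i \<in> {2..n-1} \<Longrightarrow> bracket (y 1) (y i) = - y (i + 1)"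
    and bracket_other:
      "\<lbrakk>i \<in> {1..n}; j \<in> {1..n}; \<not> (i = 1 \<and> j = 1);
        \<not> (i \<in> {2..n-1} \<and> j = 1); \<not> (i = 1 \<and> j \<in> {2..n-1})\<rbrakk>
       \<Longrightarrow> bracket (y i) (y j) = 0"
begin

sublocale self_pair: vector_space_pair scale scale ..

definition linear_extension :: "(nat \<Rightarrow> 'a) \<Rightarrow> 'a \<Rightarrow> 'a" where
  "linear_extension g = self_pair.construct (y ` {1..n}) (\<lambda>b. g (inv_into {1..n} y b))"

lemma linear_linear_extension: "Vector_Spaces.linear scale scale (linear_extension g)"
  unfolding linear_extension_def by (rule self_pair.linear_construct[OF independent_y])

lemma linear_extension_y: "i \<in> {1..n} \<Longrightarrow> linear_extension g (y i) = g i"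
  unfolding linear_extension_def
  by (subst self_pair.construct_basis[OF independent_y]) (simp_all add: inv_into_f_f[OF inj_y] del: One_nat_def)

definition h0 :: "'a \<Rightarrow> 'a" where
  "h0 = linear_extension (\<lambda>i. if i = 1 then y 1 else (2 - of_nat n + of_nat i) *s y i)"

definition h1 :: "'a \<Rightarrow> 'a" where
  "h1 = linear_extension (\<lambda>i. if i = 1 then y n else 0)"

(* For 3 - n \<le> k \<le> 0, write k = j - n with 3 \<le> j \<le> n: the value at y 1 is y (j - 1).
   Only the indices 3 - n \<le> k \<le> n - 2 are used. *)
definition d :: "int \<Rightarrow> 'a \<Rightarrow> 'a" where
  "d k = linear_extension (\<lambda>i.
     if k \<le> 0 then (if i = 1 then y (nat (k + int n) - 1) else 0)
     else (if 2 \<le> i \<and> int i \<le> int n - k then y (i + nat k) else 0))"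

lemma d_nonpos_y:
  assumes "j \<in> {3..n}" "i \<in> {1..n}"
  shows "d (int j - int n) (y i) = (if i = 1 then y (j - 1) else 0)"
  using assms by (simp add: d_def linear_extension_y)

lemma d_pos_y:
  assumes "j \<in> {1..n-2}" "i \<in> {1..n}"
  shows "d (int j) (y i) = (if i \<in> {2..n-j} then y (i + j) else 0)"
  using assms by (auto simp: d_def linear_extension_y)

end

end

theory Submission
  imports Defs
begin

text \<open>
  The algebra is generated by \<open>y 1\<close> and \<open>y 2\<close>: bracketing \<open>y 2\<close> repeatedly with \<open>y 1\<close>
  produces every further basis vector. A derivation \<open>D\<close> is therefore determined by
  \<open>D (y 1)\<close> and \<open>D (y 2)\<close>. Moreover, the first two coordinates of \<open>D (y 2)\<close> are forced by
  \<open>D (y 1)\<close>. For \<open>n = 2\<close> this is clear from \<open>y 2 = [y 1, y 1]\<close>. For \<open>n \<ge> 3\<close>, comparing the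
  Leibniz rule for \<open>[y 2, y 1]\<close> and \<open>[y 1, y 2]\<close>, which differ only by sign, shows that the first
  coordinate is 0; the second one is tied to the first coordinate of
  \<open>D (y 1)\<close>, because \<open>y n\<close> is reached in two ways, as \<open>[y 1, y 1]\<close> and as the last vector of the chain
  that starts at \<open>y 2\<close>. So \<open>D\<close> is determined by all coordinates of \<open>D (y 1)\<close> together with the
  coordinates from the third on of \<open>D (y 2)\<close> (\<open>derivation_eq_0\<close>).

  Conversely, each of the given maps is a derivation, and exactly one of these matrix entries is
  nonzero on it, with value 1; distinct maps belong to distinct entries, and every entry occurs
  (\<open>entry_derivation_at\<close>, \<open>set_positions\<close>). The entries thus are functionals dual to the given
  maps which jointly separate the points of the space of derivations, and such a dual system always
  makes the maps a basis (\<open>dual_functionals_imp_basis\<close>).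
\<close>

section \<open>Bases from dual functionals\<close>

text \<open>
  Evaluating \<open>\<phi> p\<close> on a linear combination reads off its \<open>p\<close>-th coefficient, hence independence. For
  spanning, subtract from \<open>w\<close> the combination with coefficients \<open>\<phi> q w\<close>: all functionals vanish
  on the difference, which still lies in \<open>W\<close>. Injectivity of \<open>b\<close> is part of the conclusion, so that
  the result also applies to a family listed with indices.
\<close>

lemma (in vector_space) dual_functionals_imp_basis:
  fixes \<phi> :: "'i \<Rightarrow> 'b \<Rightarrow> 'a" and b :: "'i \<Rightarrow> 'b"
  assumes fin: "finite I"
    and lin: "\<And>p. p \<in> I \<Longrightarrow> Vector_Spaces.linear scale (*) (\<phi> p)"
    and dual: "\<And>p q. p \<in> I \<Longrightarrow> q \<in> I \<Longrightarrow> \<phi> p (b q) = of_bool (p = q)"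
    and W: "subspace W" "b ` I \<subseteq> W"
    and separating: "\<And>w. w \<in> W \<Longrightarrow> (\<And>p. p \<in> I \<Longrightarrow> \<phi> p w = 0) \<Longrightarrow> w = 0"
  shows "inj_on b I" "independent (b ` I)" "span (b ` I) = W"
proof -
  have functional_combination: "\<phi> p (\<Sum>q\<in>I. c q *s b q) = c p" if p: "p \<in> I" for c p
  proof -
    interpret \<phi>: Vector_Spaces.linear scale "(*)" "\<phi> p" by (rule lin[OF p])
    have "\<phi> p (\<Sum>q\<in>I. c q *s b q) = (\<Sum>q\<in>I. c q * of_bool (p = q))"
      using dual[OF p] by (simp add: \<phi>.sum \<phi>.scale)
    also have "\<dots> = c p" using fin p by (simp add: of_bool_def if_distrib sum.delta cong: if_cong)
    finally show ?thesis .
  qed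
  show inj: "inj_on b I"
    by (rule inj_onI) (metis dual of_bool_eq_iff)
  show "independent (b ` I)"
  proof (rule independent_if_scalars_zero)
    fix f x
    assume zero: "(\<Sum>v\<in>b ` I. f v *s v) = 0" and "x \<in> b ` I"
    then obtain p where p: "p \<in> I" "x = b p" by blast
    interpret \<phi>: Vector_Spaces.linear scale "(*)" "\<phi> p" by (rule lin[OF p(1)])
    have "(\<Sum>q\<in>I. f (b q) *s b q) = 0" using zero by (simp add: sum.reindex[OF inj])
    then have "\<phi> p 0 = f (b p)" using functional_combination[OF p(1), of "\<lambda>q. f (b q)"] by simp
    then show "f x = 0" using p by (simp add: \<phi>.zero)
  qed (use fin in simp)
  show "span (b ` I) = W"
  proof
    show "span (b ` I) \<subseteq> W" using W by (rule span_minimal[rotated])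
    show "W \<subseteq> span (b ` I)"
    proof
      fix w assume w: "w \<in> W"
      define s where "s = (\<Sum>q\<in>I. \<phi> q w *s b q)"
      have "s \<in> W" unfolding s_def using W by (auto intro!: subspace_sum subspace_scale)
      have "w - s = 0"
      proof (rule separating)
        show "w - s \<in> W" using \<open>s \<in> W\<close> w W by (auto intro: subspace_diff)
        fix p assume p: "p \<in> I"
        interpret \<phi>: Vector_Spaces.linear scale "(*)" "\<phi> p" by (rule lin[OF p])
        show "\<phi> p (w - s) = 0"
          using functional_combination[OF p, of "\<lambda>q. \<phi> q w"] by (simp add: \<phi>.diff s_def)
      qed
      moreover have "s \<in> span (b ` I)" unfolding s_def
        by (intro span_sum span_scale span_base) auto
      ultimately show "w \<in> span (b ` I)" by simp
    qed
  qed
qed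

section \<open>Derivations of a Leibniz algebra\<close>

context leibniz_algebra
begin

sublocale bracket_left: Vector_Spaces.linear scale scale "\<lambda>x. bracket x z" for z
  by (rule linear_bracket_left)

sublocale bracket_right: Vector_Spaces.linear scale scale "bracket z" for z
  using linear_bracket_right[of z] by simp

lemma subspace_Der: "module.subspace (fun_scale scale) Der"
proof -
  interpret maps: vector_space "fun_scale scale"
    by (rule vector_space_fun_scale) (rule vector_space_axioms)
  have "vector_space scale" ..
  then show ?thesis
    by (intro maps.subspaceI)
      (auto simp: Der_def Vector_Spaces.linear_iff fun_scale_def plus_fun_def zero_fun_def algebra_simps
        bracket_left.add bracket_right.add bracket_left.scale bracket_right.scale
        bracket_left.zero bracket_right.zero)
qed

lemma Der_if_on_spanning_set:
  assumes "Vector_Spaces.linear scale scale D" and S: "span S = UNIV"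
    and "\<And>u v. u \<in> S \<Longrightarrow> v \<in> S \<Longrightarrow> D (bracket u v) = bracket (D u) v + bracket u (D v)"
  shows "D \<in> Der"
proof -
  interpret pair: vector_space_pair scale scale ..
  interpret D: Vector_Spaces.linear scale scale D by fact
  note add_scale = bracket_left.add bracket_right.add bracket_left.scale bracket_right.scale
    D.add D.scale
  have left: "D (bracket u v) = bracket (D u) v + bracket u (D v)" if v: "v \<in> S" for u v
    by (rule pair.linear_eq_on[where B = S and x = u])
      (use assms v in \<open>auto simp: Vector_Spaces.linear_iff add_scale algebra_simps\<close>)
  have "D (bracket u v) = bracket (D u) v + bracket u (D v)" for u v
    by (rule pair.linear_eq_on[where B = S and x = v])
      (use assms left in \<open>auto simp: Vector_Spaces.linear_iff add_scale algebra_simps\<close>)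
  then show ?thesis using assms(1) by (simp add: Der_def)
qed

end

section \<open>Products and coordinates in the algebra\<close>

context M4_algebra
begin

lemma bracket_y:
  assumes "i \<in> {1..n}" "j \<in> {1..n}"
  shows "bracket (y i) (y j) =
    (if i = 1 \<and> j = 1 then y n
     else if j = 1 \<and> i < n then y (i + 1)
     else if i = 1 \<and> j < n then - y (j + 1) else 0)"
proof -
  have "{2..n-1} = {2..<n}" using n_ge_2 by auto
  then show ?thesis
    using assms bracket_1_1 bracket_i_1[of i] bracket_1_i[of j] bracket_other[of i j]
    by (auto simp del: One_nat_def)
qed

definition coord :: "nat \<Rightarrow> 'a \<Rightarrow> complex" where
  "coord j v = representation (y ` {1..n}) v (y j)"

lemma linear_coord: "Vector_Spaces.linear scale (*) (coord j)"
proof -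
  have "vector_space ((*) :: complex \<Rightarrow> complex \<Rightarrow> complex)"
    by unfold_locales (auto simp: algebra_simps)
  then show ?thesis
    using vector_space_axioms
    by (simp add: Vector_Spaces.linear_iff coord_def representation_add representation_scale
        independent_y span_y del: One_nat_def)
qed

sublocale coord: Vector_Spaces.linear scale "(*)" "coord j" for j
  by (rule linear_coord)

lemma coord_y: "i \<in> {1..n} \<Longrightarrow> j \<in> {1..n} \<Longrightarrow> coord j (y i) = of_bool (i = j)"
  by (simp add: coord_def representation_basis[OF independent_y] inj_on_eq_iff[OF inj_y]
      del: One_nat_def)

lemma sum_coord: "(\<Sum>j\<in>{1..n}. coord j v *s y j) = v"
proof -
  have "(\<Sum>b\<in>y ` {1..n}. representation (y ` {1..n}) v b *s b) = v"
    by (rule sum_representation_eq) (simp_all add: independent_y span_y del: One_nat_def)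
  then show ?thesis by (simp add: sum.reindex[OF inj_y] coord_def del: One_nat_def)
qed

lemma linear_map_eq_0_if_on_basis:
  assumes "Vector_Spaces.linear scale scale D" and "\<And>i. i \<in> {1..n} \<Longrightarrow> D (y i) = 0"
  shows "D = 0"
proof
  fix v
  show "D v = 0 v"
    unfolding zero_fun_apply
    by (rule self_pair.linear_eq_0_on_span[OF assms(1), of "y ` {1..n}"])
      (use assms(2) span_y in auto)
qed

section \<open>A derivation is determined by few matrix entries\<close>

text \<open>
  If \<open>D\<close> kills \<open>y 1\<close>, it also kills \<open>y n = [y 1, y 1]\<close>, which settles dimension two. In higher
  dimension \<open>D (y 2) = a y 1 + b y 2\<close>. The products \<open>[y 2, y 1] = y 3\<close> and \<open>[y 1, y 2] = - y 3\<close>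
  give \<open>D (y 3) = a y n + b y 3\<close> and \<open>- D (y 3) = a y n - b y 3\<close>, so \<open>a = 0\<close>. Right multiplication
  by \<open>y 1\<close> commutes with \<open>D\<close> because \<open>D (y 1) = 0\<close>, so \<open>D\<close> acts on the whole chain from \<open>y 2\<close> to
  \<open>y n\<close> as the scalar \<open>b\<close>, and \<open>D (y n) = 0\<close> forces \<open>b = 0\<close>.
\<close>

lemma derivation_eq_0:
  assumes "D \<in> Der"
    and row1: "\<And>j. j \<in> {1..n} \<Longrightarrow> coord j (D (y 1)) = 0"
    and row2: "\<And>j. j \<in> {3..n} \<Longrightarrow> coord j (D (y 2)) = 0"
  shows "D = 0"
proof -
  have linD: "Vector_Spaces.linear scale scale D"
    and leibniz: "\<And>u v. D (bracket u v) = bracket (D u) v + bracket u (D v)"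
    using assms(1) by (auto simp: Der_def)
  interpret D: Vector_Spaces.linear scale scale D by (rule linD)
  have D1: "D (y 1) = 0"
    using sum_coord[of "D (y 1)"] row1 by simp
  have Dn: "D (y n) = 0"
    using leibniz[of "y 1" "y 1"]
    by (simp add: D1 bracket_1_1 del: One_nat_def)
  show ?thesis
  proof (cases "n = 2")
    case True
    then have "i = 1 \<or> i = n" if "i \<in> {1..n}" for i using that by auto
    then have "D (y i) = 0" if "i \<in> {1..n}" for i using that D1 Dn by metis
    then show ?thesis by (rule linear_map_eq_0_if_on_basis[OF linD])
  next
    case False
    then have n: "n \<ge> 3" using n_ge_2 by simp
    define a where "a = coord 1 (D (y 2))"
    define b where "b = coord 2 (D (y 2))"
    have "{1..n} = insert 1 (insert 2 {3..n})" using n by auto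
    then have "(\<Sum>j\<in>{1..n}. coord j (D (y 2)) *s y j)
        = a *s y 1 + (b *s y 2 + (\<Sum>j\<in>{3..n}. coord j (D (y 2)) *s y j))"
      by (simp add: a_def b_def)
    then have D2: "D (y 2) = a *s y 1 + b *s y 2"
      using sum_coord[of "D (y 2)"] row2 by simp
    have br: "bracket (y 2) (y 1) = y 3" "bracket (y 1) (y 2) = - y 3"
      using n by (simp_all add: bracket_y)
    have "D (y 3) = a *s y n + b *s y 3"
      using leibniz[of "y 2" "y 1"] br bracket_1_1
      by (simp add: D1 D2 bracket_left.add bracket_left.scale del: One_nat_def)
    moreover have "- D (y 3) = a *s y n - b *s y 3"
      using leibniz[of "y 1" "y 2"] br bracket_1_1
      by (simp add: D1 D2 bracket_right.add bracket_right.scale D.neg del: One_nat_def)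
    ultimately have "- (a *s y n) = a *s y n" by (simp add: algebra_simps)
    then have "a *s y n + a *s y n = 0" by (metis add.left_inverse)
    then have "(a + a) *s y n = 0" by (simp only: scale_left_distrib)
    moreover have yn: "y n \<noteq> 0"
      using coord_y[of n n] n by (auto simp: coord.zero)
    ultimately have "a = 0" by simp
    have Di: "D (y i) = b *s y i" if "i \<ge> 2" "i \<le> n" for i
      using that
    proof (induction i rule: dec_induct)
      case base
      then show ?case by (simp add: D2 \<open>a = 0\<close>)
    next
      case (step i)
      then have "bracket (y i) (y 1) = y (Suc i)" by (simp add: bracket_y)
      then show ?case
        using leibniz[of "y i" "y 1"] step
        by (simp add: D1 bracket_left.scale bracket_right.zero del: One_nat_def)
    qed
    have "b = 0" using Di[of n] Dn yn n by simp
    have "D (y i) = 0" if "i \<in> {1..n}" for i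
    proof (cases "i = 1")
      case False
      then show ?thesis using that Di[of i] \<open>b = 0\<close> by simp
    qed (use D1 in simp)
    then show ?thesis by (rule linear_map_eq_0_if_on_basis[OF linD])
  qed
qed

section \<open>The given maps are derivations\<close>

lemma h0_y: "i \<in> {1..n} \<Longrightarrow> h0 (y i) = (if i = 1 then y 1 else (2 - of_nat n + of_nat i) *s y i)"
  by (simp add: h0_def linear_extension_y del: One_nat_def)

lemma h1_y: "i \<in> {1..n} \<Longrightarrow> h1 (y i) = (if i = 1 then y n else 0)"
  by (simp add: h1_def linear_extension_y del: One_nat_def)

lemmas bracket_simps = bracket_left.add bracket_right.add bracket_left.scale bracket_right.scale
  bracket_left.neg bracket_right.neg bracket_y

text \<open>
  The map \<open>h0\<close> is diagonal, so it is a derivation iff its weights add up along every nonzero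
  product. The weight of \<open>y (i + 1)\<close> exceeds that of \<open>y i\<close> by the weight 1 of \<open>y 1\<close>, and the offset
  \<open>2 - n\<close> gives \<open>y n = [y 1, y 1]\<close> the weight 2.
\<close>

lemma h0_in_Der: "h0 \<in> Der"
proof -
  have scale_2: "2 *s v = v + v" and scale_3: "3 *s v = v + (v + v)" for v
    using scale_left_distrib[of 1 1 v] scale_left_distrib[of 1 2 v] by simp_all
  interpret h0: Vector_Spaces.linear scale scale h0
    unfolding h0_def by (rule linear_linear_extension)
  show ?thesis
  proof (rule Der_if_on_spanning_set[OF _ span_y])
    fix u v assume "u \<in> y ` {1..n}" "v \<in> y ` {1..n}"
    then obtain i j where "i \<in> {1..n}" "j \<in> {1..n}" "u = y i" "v = y j" by blast
    then show "h0 (bracket u v) = bracket (h0 u) v + bracket u (h0 v)"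
      using n_ge_2 by (simp add: bracket_simps h0_y h0.neg h0.zero del: One_nat_def)
        (auto simp: algebra_simps scale_2 scale_3)
  qed (rule h0.linear_axioms)
qed

lemma h1_in_Der: "h1 \<in> Der"
proof -
  interpret h1: Vector_Spaces.linear scale scale h1
    unfolding h1_def by (rule linear_linear_extension)
  show ?thesis
  proof (rule Der_if_on_spanning_set[OF _ span_y])
    fix u v assume "u \<in> y ` {1..n}" "v \<in> y ` {1..n}"
    then obtain i j where "i \<in> {1..n}" "j \<in> {1..n}" "u = y i" "v = y j" by blast
    then show "h1 (bracket u v) = bracket (h1 u) v + bracket u (h1 v)"
      using n_ge_2 by (simp add: bracket_simps h1_y h1.neg h1.zero)
  qed (rule h1.linear_axioms)
qed

text \<open>
  The only critical product is \<open>[y 1, y 1] = y n\<close>: the two terms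
  \<open>[y (k - 1), y 1]\<close> and \<open>[y 1, y (k - 1)]\<close> cancel because \<open>k - 1\<close> lies strictly between
  1 and \<open>n\<close>.
\<close>

lemma d_nonpos_in_Der:
  assumes "k \<in> {3..n}"
  shows "d (int k - int n) \<in> Der"
proof -
  have k: "2 \<le> k - 1" "k - 1 < n" using assms by auto
  interpret d: Vector_Spaces.linear scale scale "d (int k - int n)"
    unfolding d_def by (rule linear_linear_extension)
  show ?thesis
  proof (rule Der_if_on_spanning_set[OF _ span_y])
    fix u v assume "u \<in> y ` {1..n}" "v \<in> y ` {1..n}"
    then obtain i j where "i \<in> {1..n}" "j \<in> {1..n}" "u = y i" "v = y j" by blast
    then show "d (int k - int n) (bracket u v)
        = bracket (d (int k - int n) u) v + bracket u (d (int k - int n) v)"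
      using assms k by (auto simp: bracket_simps d_nonpos_y d.neg d.zero simp del: One_nat_def)
  qed (rule d.linear_axioms)
qed

text \<open>
  A shift along the chain \<open>y 2, \<dots>, y n\<close> commutes with multiplication by \<open>y 1\<close> on either side,
  and it kills \<open>y 1\<close> and \<open>[y 1, y 1] = y n\<close>.
\<close>

lemma d_pos_in_Der:
  assumes "k \<in> {1..n-2}"
  shows "d (int k) \<in> Der"
proof -
  interpret d: Vector_Spaces.linear scale scale "d (int k)"
    unfolding d_def by (rule linear_linear_extension)
  show ?thesis
  proof (rule Der_if_on_spanning_set[OF _ span_y])
    fix u v assume "u \<in> y ` {1..n}" "v \<in> y ` {1..n}"
    then obtain i j where "i \<in> {1..n}" "j \<in> {1..n}" "u = y i" "v = y j" by blast
    then show "d (int k) (bracket u v) = bracket (d (int k) u) v + bracket u (d (int k) v)"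
      using assms by (auto simp: bracket_simps d_pos_y d.neg d.zero)
  qed (rule d.linear_axioms)
qed

section \<open>The given maps and the matrix entries are dual\<close>

definition positions :: "(nat \<times> nat) set" where
  "positions = {1} \<times> {1..n} \<union> {2} \<times> {3..n}"

definition entry :: "nat \<times> nat \<Rightarrow> ('a \<Rightarrow> 'a) \<Rightarrow> complex" where
  "entry p D = coord (snd p) (D (y (fst p)))"

text \<open>
  The given map on which, among the entries in \<open>positions\<close>, precisely the entry at \<open>p\<close> is nonzero.
\<close>

definition derivation_at :: "nat \<times> nat \<Rightarrow> 'a \<Rightarrow> 'a" where
  "derivation_at p =
    (if p = (1, 1) then h0 else if p = (1, n) then h1
     else if fst p = 1 then d (int (snd p) + 1 - int n) else d (int (snd p) - 2))"

text \<open>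
  On the range of indices in question this inverts \<open>derivation_at\<close>: the integer index of \<open>d\<close> is
  \<open>j + 1 - n\<close> in row 1 and \<open>j - 2\<close> in row 2.
\<close>

definition position_of_d :: "int \<Rightarrow> nat \<times> nat" where
  "position_of_d k = (if k \<le> 0 then (1, nat (k + int n - 1)) else (2, nat (k + 2)))"

text \<open>
  The parameters \<open>k\<close> are those with which the values of \<open>d\<close> on basis vectors are described, so that
  \<open>d_nonpos_y\<close> and \<open>d_pos_y\<close> apply verbatim.
\<close>

lemma positions_cases [consumes 1, case_names h0 h1 nonpos pos]:
  assumes "p \<in> positions"
  obtains "p = (1, 1)" "derivation_at p = h0"
    | "p = (1, n)" "derivation_at p = h1"
    | k where "k \<in> {3..n}" "p = (1, k - 1)" "derivation_at p = d (int k - int n)"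
    | k where "k \<in> {1..n-2}" "p = (2, k + 2)" "derivation_at p = d (int k)"
proof -
  obtain i j where p: "p = (i, j)" by (cases p)
  consider "i = 1" "j = 1" | "i = 1" "j = n" | "i = 1" "j \<in> {2..n-1}" | "i = 2" "j \<in> {3..n}"
    using assms by (fastforce simp: positions_def p)
  then show thesis
  proof cases
    case 1
    then show thesis by (intro that(1)) (simp_all add: p derivation_at_def)
  next
    case 2
    then show thesis using n_ge_2 by (intro that(2)) (simp_all add: p derivation_at_def)
  next
    case 3
    then show thesis by (intro that(3)[of "j + 1"]) (auto simp: p derivation_at_def algebra_simps)
  next
    case 4
    then show thesis by (intro that(4)[of "j - 2"]) (auto simp: p derivation_at_def of_nat_diff)
  qed
qed

lemma derivation_at_in_Der: "p \<in> positions \<Longrightarrow> derivation_at p \<in> Der"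
  by (cases p rule: positions_cases) (simp_all add: h0_in_Der h1_in_Der d_nonpos_in_Der d_pos_in_Der)

text \<open>
  In row 1 the maps \<open>h0\<close>, \<open>d\<close> with nonpositive index, and \<open>h1\<close> send \<open>y 1\<close> to the successive basis
  vectors \<open>y 1, \<dots>, y n\<close>. The \<open>d\<close> with positive index send \<open>y 1\<close> to 0 and \<open>y 2\<close> to \<open>y 3, \<dots>, y n\<close>.
  The only other nonzero value on these two vectors is that of \<open>h0\<close> at \<open>y 2\<close>, a multiple of \<open>y 2\<close>,
  which no entry in \<open>positions\<close> sees.
\<close>

lemma entry_derivation_at:
  assumes "p \<in> positions" "q \<in> positions"
  shows "entry p (derivation_at q) = of_bool (p = q)"
proof -
  obtain i j where p: "p = (i, j)" by (cases p)
  have ij: "i \<in> {1..n}" "j \<in> {1..n}" "i = 1 \<or> i = 2 \<and> 3 \<le> j"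
    using assms(1) n_ge_2 by (auto simp: p positions_def)
  from assms(2) show ?thesis
  proof (cases q rule: positions_cases)
    case h0
    then show ?thesis using ij by (auto simp: p entry_def h0_y coord_y coord.scale)
  next
    case h1
    then show ?thesis using ij by (auto simp: p entry_def h1_y coord_y coord.zero)
  next
    case (nonpos k)
    then have "2 \<le> k - 1" "k - 1 < n" by auto
    with nonpos show ?thesis
      using ij by (auto simp: p entry_def d_nonpos_y coord_y coord.zero simp del: One_nat_def)
  next
    case (pos k)
    then show ?thesis using ij by (auto simp: p entry_def d_pos_y coord_y coord.zero)
  qed
qed

lemma linear_entry: "Vector_Spaces.linear (fun_scale scale) (*) (entry p)"
proof -
  interpret maps: vector_space "fun_scale scale"
    by (rule vector_space_fun_scale) (rule vector_space_axioms)
  show ?thesis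
    using linear_coord maps.vector_space_axioms
    by (auto simp: Vector_Spaces.linear_iff entry_def fun_scale_def plus_fun_def)
qed

lemma map_derivation_at:
  "map derivation_at ((1, 1) # (1, n) # map position_of_d [3 - int n..int n - 2])
    = h0 # h1 # map d [3 - int n..int n - 2]"
  using n_ge_2 by (auto simp: derivation_at_def position_of_d_def)

lemma set_positions:
  "set ((1, 1) # (1, n) # map position_of_d [3 - int n..int n - 2]) = positions"
    (is "?L = _")
proof
  show "?L \<subseteq> positions" using n_ge_2 by (auto simp: positions_def position_of_d_def)
  show "positions \<subseteq> ?L"
  proof
    fix p assume "p \<in> positions"
    then show "p \<in> ?L"
    proof (cases p rule: positions_cases)
      case (nonpos k)
      then have "p = position_of_d (int k - int n)" "int k - int n \<in> {3 - int n..int n - 2}"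
        by (auto simp: position_of_d_def)
      then show ?thesis by simp
    next
      case (pos k)
      then have "p = position_of_d (int k)" "int k \<in> {3 - int n..int n - 2}"
        by (auto simp: position_of_d_def)
      then show ?thesis by simp
    qed simp_all
  qed
qed

lemma distinct_positions:
  "distinct ((1, 1) # (1, n) # map position_of_d [3 - int n..int n - 2])"
  using n_ge_2 by (auto simp: distinct_map inj_on_def position_of_d_def split: if_splits)

end

theorem proposition4p3:
  fixes scale :: "complex \<Rightarrow> 'a::ab_group_add \<Rightarrow> 'a"
    and bracket :: "'a \<Rightarrow> 'a \<Rightarrow> 'a"
    and y :: "nat \<Rightarrow> 'a" and n :: nat
  assumes "M4_algebra scale bracket y n"
  shows "let B = M4_algebra.h0 scale y n # M4_algebra.h1 scale y n
                 # map (M4_algebra.d scale y n) [3 - int n..int n - 2]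
         in distinct B
            \<and> \<not> module.dependent (fun_scale scale) (set B)
            \<and> module.span (fun_scale scale) (set B) = leibniz_algebra.Der scale bracket"
proof -
  interpret M4_algebra scale bracket y n by fact
  interpret maps: vector_space "fun_scale scale"
    by (rule vector_space_fun_scale) (rule vector_space_axioms)
  have separating: "D = 0" if "D \<in> Der" "\<And>p. p \<in> positions \<Longrightarrow> entry p D = 0" for D
  proof (rule derivation_eq_0[OF that(1)])
    show "coord j (D (y 1)) = 0" if "j \<in> {1..n}" for j
      using that \<open>\<And>p. p \<in> positions \<Longrightarrow> entry p D = 0\<close>[of "(1, j)"]
      by (simp add: entry_def positions_def)
    show "coord j (D (y 2)) = 0" if "j \<in> {3..n}" for j
      using that \<open>\<And>p. p \<in> positions \<Longrightarrow> entry p D = 0\<close>[of "(2, j)"]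
      by (simp add: entry_def positions_def)
  qed
  have "finite positions" by (simp add: positions_def)
  note basis = maps.dual_functionals_imp_basis[OF this linear_entry entry_derivation_at
      subspace_Der _ separating]
  have "derivation_at ` positions \<subseteq> Der" using derivation_at_in_Der by blast
  note basis = basis[OF _ _ this]
  have set_B: "set (h0 # h1 # map d [3 - int n..int n - 2]) = derivation_at ` positions"
    unfolding map_derivation_at[symmetric] set_map set_positions ..
  have "distinct (h0 # h1 # map d [3 - int n..int n - 2])"
    unfolding map_derivation_at[symmetric] distinct_map set_positions
    using distinct_positions basis(1) by blast
  then show ?thesis
    unfolding Let_def set_B using basis(2,3) by blast
qed

end
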